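(* Let an element $b\in L$ be $\phi$-$\delta$-primary to a proper element $p\in L$. If $b$ is $\delta$-primary to $\phi(p)$ then $b$ is $\delta$-primary to $p$.
   Context: A multiplicative lattice is a complete lattice (least element $0$, largest element $1$) with a commutative, associative multiplication that distributes over arbitrary joins and has $1$ as multiplicative identity. An element $a$ is compact if whenever $a\leqslant \vee X$ for $X\subseteq L$ there are finitely many $a_1,\dots,a_n\in X$ with $a\leqslant a_1\vee\cdots\vee a_n$. Standing assumptions: $L$ is a compactly generated multiplicative lattice (every element is a join of compact elements), $1$ is compact, and every finite product of compact elements is compact. An element $p$ is proper if $p<1$. $\delta:L\to L$ is an expansion function: $a\leqslant\delta(a)$ for all $a$, and $a\leqslant b$ implies $\delta(a)\leqslant\delta(b)$. $\phi:L\to L$ is a function, assumed to satisfy $\phi(q)\leqslant q$ for all $q\in L$. An element $b$ is $\delta$-primary to a proper element $p$ if for all $x\in L$, $xb\leqslant p$ implies $x\leqslant\delta(p)$; it is $\phi$-$\delta$-primary to $p$ if for all $x\in L$, $xb\leqslant p$ and $xb\not\leqslant\phi(p)$ implies $x\leqslant\delta(p)$. *)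

theory Defs
  imports Main
begin

text \<open>The least and greatest elements 0 and 1 of the lattice are \<^term>\<open>bot\<close> and \<^term>\<open>top\<close>;
  the greatest element is identified with the multiplicative unit \<^term>\<open>1\<close>.\<close>

class multiplicative_lattice = complete_lattice + comm_monoid_mult +
  assumes one_eq_top: "1 = top"
    and mult_Sup_distrib: "a * Sup X = Sup ((\<lambda>x. a * x) ` X)"

definition (in complete_lattice) compact_element :: "'a \<Rightarrow> bool" where
  "compact_element a \<longleftrightarrow>
     (\<forall>X. a \<le> Sup X \<longrightarrow> (\<exists>F. finite F \<and> F \<subseteq> X \<and> a \<le> Sup F))"

text \<open>Finite products are products of lists, so that repeated factors are allowed.\<close>

class compactly_generated_multiplicative_lattice = multiplicative_lattice +
  assumes compactly_generated: "\<exists>X. (\<forall>c\<in>X. compact_element c) \<and> a = Sup X"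
    and compact_element_one: "compact_element 1"
    and compact_element_prod_list:
      "(\<forall>c\<in>set cs. compact_element c) \<Longrightarrow> compact_element (prod_list cs)"

definition expansion_function :: "('a::multiplicative_lattice \<Rightarrow> 'a) \<Rightarrow> bool" where
  "expansion_function \<delta> \<longleftrightarrow> (\<forall>a. a \<le> \<delta> a) \<and> (\<forall>a b. a \<le> b \<longrightarrow> \<delta> a \<le> \<delta> b)"

text \<open>Being primary to \<open>p\<close> is only defined for proper \<open>p\<close>; the predicates below are false
  for the improper element.\<close>

definition delta_primary_to ::
    "('a::multiplicative_lattice \<Rightarrow> 'a) \<Rightarrow> 'a \<Rightarrow> 'a \<Rightarrow> bool" where
  "delta_primary_to \<delta> b p \<longleftrightarrow> p < 1 \<and> (\<forall>x. x * b \<le> p \<longrightarrow> x \<le> \<delta> p)"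

definition phi_delta_primary_to ::
    "('a::multiplicative_lattice \<Rightarrow> 'a) \<Rightarrow> ('a \<Rightarrow> 'a) \<Rightarrow> 'a \<Rightarrow> 'a \<Rightarrow> bool" where
  "phi_delta_primary_to \<phi> \<delta> b p \<longleftrightarrow>
     p < 1 \<and> (\<forall>x. x * b \<le> p \<and> \<not> x * b \<le> \<phi> p \<longrightarrow> x \<le> \<delta> p)"

end

theory Submission imports Defs begin

text \<open>The condition \<open>\<not> x * b \<le> \<phi> p\<close> is all that separates the two
  notions of primary to \<open>p\<close>. When it fails, \<open>x * b\<close> lies below
  \<open>\<phi> p\<close>, and primariness to \<open>\<phi> p\<close> bounds \<open>x\<close> by
  \<open>\<delta> (\<phi> p)\<close>, which is at most \<open>\<delta> p\<close>.\<close>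

theorem theorem2p29:
  fixes \<delta> \<phi> :: "'a::compactly_generated_multiplicative_lattice \<Rightarrow> 'a"
    and b p :: 'a
  assumes "expansion_function \<delta>"
    and "\<And>q. \<phi> q \<le> q"
    and "p < 1"
    and "phi_delta_primary_to \<phi> \<delta> b p"
    and "delta_primary_to \<delta> b (\<phi> p)"
  shows "delta_primary_to \<delta> b p"
proof -
  have "x \<le> \<delta> p" if "x * b \<le> p" for x
  proof (cases "x * b \<le> \<phi> p")
    case True
    then have "x \<le> \<delta> (\<phi> p)"
      using assms(5) by (simp add: delta_primary_to_def)
    \<comment> \<open>Monotonicity of \<open>\<delta>\<close> applied to
      \<open>\<phi> p \<le> p\<close>.\<close>
    also have "\<dots> \<le> \<delta> p"
      using assms(1,2) by (simp add: expansion_function_def)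
    finally show ?thesis .
  next
    case False
    with that assms(4) show ?thesis
      by (simp add: phi_delta_primary_to_def)
  qed
  with assms(3) show ?thesis
    by (simp add: delta_primary_to_def)
qed

end
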